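(* The problem of computing the degree of responsibility in read-once Boolean formulas can be solved in linear time: there is an algorithm that, given a read-once Boolean formula $\varphi$ in positive normal form over variables $\vec{X}$, a variable $X\in\vec{X}$ and an assignment $f:\vec{X}\to\{0,1\}$, computes $dr(\varphi,X,f)$ in time linear in the size of the input.
   Context: A Boolean formula is read-once if each variable appears in it only once; it is in positive normal form if negation is applied only to atomic propositions. Such a formula is viewed as a Boolean circuit (a tree) with binary $\wedge,\vee$ gates. An assignment $f$ extends to all gates by evaluation. For $\vec{Z}\subseteq\vec{X}$, $\tilde f_{\vec{Z}}$ is the assignment that differs from $f$ exactly on the variables in $\vec{Z}$; $\tilde f_X=\tilde f_{\{X\}}$. $X$ is critical for gate $w$ under $f$ if $\tilde f_X(w)\neq f(w)$. A set $\vec{Z}\subseteq\vec{X}\setminus\{X\}$ makes $X$ critical for $w$ under $f$ if $\tilde f_{\vec{Z}}(w)=f(w)$ and $X$ is critical for $w$ under $\tilde f_{\vec{Z}}$. The degree of responsibility $dr(\varphi,X,f)$ of $X$ for the value of the output (root) under $f$ is $1/(1+|\vec{Z}|)$ for a minimal-size set $\vec{Z}$ making $X$ critical for the root, and $0$ if no such set exists. *)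

theory Defs
  imports Complex_Main
begin

datatype 'v formula =
    Var 'v
  | Neg "'v formula"
  | Conj "'v formula" "'v formula"
  | Disj "'v formula" "'v formula"

text \<open>The gates of the circuit of a formula are its subformulas (each gate is the root of
  its own subtree), so the value of a gate is the value of the subformula.\<close>

fun eval :: "('v \<Rightarrow> bool) \<Rightarrow> 'v formula \<Rightarrow> bool" where
  "eval f (Var x) = f x"
| "eval f (Neg p) = (\<not> eval f p)"
| "eval f (Conj p q) = (eval f p \<and> eval f q)"
| "eval f (Disj p q) = (eval f p \<or> eval f q)"

fun var_list :: "'v formula \<Rightarrow> 'v list" where
  "var_list (Var x) = [x]"
| "var_list (Neg p) = var_list p"
| "var_list (Conj p q) = var_list p @ var_list q"
| "var_list (Disj p q) = var_list p @ var_list q"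

definition vars :: "'v formula \<Rightarrow> 'v set" where
  "vars p = set (var_list p)"

definition read_once :: "'v formula \<Rightarrow> bool" where
  "read_once p \<longleftrightarrow> distinct (var_list p)"

fun positive_normal_form :: "'v formula \<Rightarrow> bool" where
  "positive_normal_form (Var x) = True"
| "positive_normal_form (Neg p) = (\<exists>x. p = Var x)"
| "positive_normal_form (Conj p q) = (positive_normal_form p \<and> positive_normal_form q)"
| "positive_normal_form (Disj p q) = (positive_normal_form p \<and> positive_normal_form q)"

definition flip :: "('v \<Rightarrow> bool) \<Rightarrow> 'v set \<Rightarrow> 'v \<Rightarrow> bool" where
  "flip f Z = (\<lambda>x. if x \<in> Z then \<not> f x else f x)"

definition critical :: "'v \<Rightarrow> 'v formula \<Rightarrow> ('v \<Rightarrow> bool) \<Rightarrow> bool" where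
  "critical X w f \<longleftrightarrow> eval (flip f {X}) w \<noteq> eval f w"

definition makes_critical ::
  "'v set \<Rightarrow> 'v set \<Rightarrow> 'v \<Rightarrow> 'v formula \<Rightarrow> ('v \<Rightarrow> bool) \<Rightarrow> bool" where
  "makes_critical V Z X w f \<longleftrightarrow>
     Z \<subseteq> V - {X} \<and> eval (flip f Z) w = eval f w \<and> critical X w (flip f Z)"

text \<open>\<open>V\<close> is the set of all variables and is meant to be finite, since \<open>card\<close> is \<open>0\<close> on
  infinite sets. The assignment is a total function, but only its values on \<open>V\<close> matter
  when \<open>vars p \<subseteq> V\<close>.\<close>

definition dr :: "'v set \<Rightarrow> 'v formula \<Rightarrow> 'v \<Rightarrow> ('v \<Rightarrow> bool) \<Rightarrow> rat" where
  "dr V p X f =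
     (if \<exists>Z. makes_critical V Z X p f
      then 1 / (1 + of_nat (LEAST n. \<exists>Z. makes_critical V Z X p f \<and> card Z = n))
      else 0)"

text \<open>The machine model is a random access machine with unit-cost instructions. A program
  is a finite list of instructions; it can name finitely many registers directly, and it reaches
  the memory cells only through an address held in a register. Subtraction is truncated, there
  is no multiplication, and a program halts when the program counter leaves it.\<close>

datatype instr =
    Set nat nat
  | Move nat nat
  | Add nat nat nat
  | Sub nat nat nat
  | Load nat nat
  | Store nat nat
  | Jump nat
  | JumpZero nat nat

datatype config = Config (pc: nat) (reg: "nat \<Rightarrow> nat") (mem: "nat \<Rightarrow> nat")

fun exec_instr :: "instr \<Rightarrow> config \<Rightarrow> config" where
  "exec_instr (Set r n) (Config l R M) = Config (l + 1) (R(r := n)) M"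
| "exec_instr (Move r a) (Config l R M) = Config (l + 1) (R(r := R a)) M"
| "exec_instr (Add r a b) (Config l R M) = Config (l + 1) (R(r := R a + R b)) M"
| "exec_instr (Sub r a b) (Config l R M) = Config (l + 1) (R(r := R a - R b)) M"
| "exec_instr (Load r a) (Config l R M) = Config (l + 1) (R(r := M (R a))) M"
| "exec_instr (Store a r) (Config l R M) = Config (l + 1) R (M(R a := R r))"
| "exec_instr (Jump l') (Config l R M) = Config l' R M"
| "exec_instr (JumpZero r l') (Config l R M) = Config (if R r = 0 then l' else l + 1) R M"

definition halted :: "instr list \<Rightarrow> config \<Rightarrow> bool" where
  "halted P s \<longleftrightarrow> length P \<le> pc s"

definition step :: "instr list \<Rightarrow> config \<Rightarrow> config" where
  "step P s = (if halted P s then s else exec_instr (P ! pc s) s)"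

definition initial :: "nat list \<Rightarrow> config" where
  "initial xs =
     Config 0 ((\<lambda>_. 0)(0 := length xs)) (\<lambda>i. if i < length xs then xs ! i else 0)"

text \<open>Started on input \<open>xs\<close>, the program \<open>P\<close> halts after at most \<open>t\<close> steps with \<open>a\<close> and \<open>b\<close> in
  registers 0 and 1. The bound \<open>w\<close> on all numbers that occur during the run makes unit cost
  realistic: with \<open>w\<close> linear in the input length, words have logarithmically many bits.\<close>

definition runs :: "instr list \<Rightarrow> nat list \<Rightarrow> nat \<Rightarrow> nat \<Rightarrow> nat \<Rightarrow> nat \<Rightarrow> bool" where
  "runs P xs t w a b \<longleftrightarrow>
     (\<exists>n \<le> t. let s = (\<lambda>i. (step P ^^ i) (initial xs)) in
        halted P (s n) \<and> reg (s n) 0 = a \<and> reg (s n) 1 = b \<and>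
        (\<forall>i \<le> n. \<forall>j. reg (s i) j \<le> w \<and> mem (s i) j \<le> w))"

text \<open>A formula is written down in the usual fully parenthesised infix notation, one machine
  word per symbol: \<open>0\<close> and \<open>1\<close> are the left and the right parenthesis, \<open>2\<close> is conjunction,
  \<open>3\<close> is disjunction, \<open>4\<close> is negation, and \<open>5 + x\<close> is the variable with index \<open>x\<close>.\<close>

fun encode :: "nat formula \<Rightarrow> nat list" where
  "encode (Var x) = [5 + x]"
| "encode (Neg p) = 4 # encode p"
| "encode (Conj p q) = [0] @ encode p @ [2] @ encode q @ [1]"
| "encode (Disj p q) = [0] @ encode p @ [3] @ encode q @ [1]"

text \<open>The input for variables \<open>0, \<dots>, k - 1\<close>: the number of variables, the table of the
  assignment, the distinguished variable and the formula.\<close>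

definition input :: "nat \<Rightarrow> (nat \<Rightarrow> bool) \<Rightarrow> nat \<Rightarrow> nat formula \<Rightarrow> nat list" where
  "input k f X p = [k] @ map (\<lambda>i. of_bool (f i)) [0..<k] @ [X] @ encode p"

end

theory Submission
  imports Defs
begin

text \<open>Every gate \<open>p\<close> of a read-once formula is monotone in each literal, and its two inputs
  share no variable. Hence the least number \<open>cost f b p\<close> of variables that must be flipped
  to give \<open>p\<close> the value \<open>b\<close> satisfies a recursion with sums and minima. A variable \<open>X\<close> below
  an input \<open>p\<close> of a conjunction is critical for the conjunction iff it is critical for \<open>p\<close> and
  the other input is true (dually for disjunctions), so the least size of a set that makes \<open>X\<close>
  critical is a sum of such costs along the path from \<open>X\<close> to the root. When \<open>X\<close> is
  critical for the root, the root has the value of the literal of \<open>X\<close>; therefore the value of the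
  root is preserved either by all sets after which \<open>X\<close> is critical or by none of them.
  A single pass over the fully parenthesised formula with one stack computes these quantities.\<close>

section \<open>Criticality in read-once formulas\<close>

lemma vars_simps [simp]:
  "vars (Var x) = {x}" "vars (Neg p) = vars p"
  "vars (Conj p q) = vars p \<union> vars q" "vars (Disj p q) = vars p \<union> vars q"
  by (simp_all add: vars_def)

lemma finite_vars [simp]: "finite (vars p)"
  by (simp add: vars_def)

lemma read_once_simps [simp]:
  "read_once (Var x)" "read_once (Neg p) \<longleftrightarrow> read_once p"
  "read_once (Conj p q) \<longleftrightarrow> read_once p \<and> read_once q \<and> vars p \<inter> vars q = {}"
  "read_once (Disj p q) \<longleftrightarrow> read_once p \<and> read_once q \<and> vars p \<inter> vars q = {}"
  by (auto simp: read_once_def vars_def)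

lemma eval_cong: "(\<And>x. x \<in> vars p \<Longrightarrow> f x = g x) \<Longrightarrow> eval f p = eval g p"
  by (induction p) auto

lemma eval_flip_cong:
  "Z \<inter> vars p = Z' \<inter> vars p \<Longrightarrow> eval (flip f Z) p = eval (flip f Z') p"
  by (rule eval_cong) (auto simp: flip_def)

section \<open>Least numbers of flips that give a gate a prescribed value\<close>

fun cost :: "('v \<Rightarrow> bool) \<Rightarrow> bool \<Rightarrow> 'v formula \<Rightarrow> nat" where
  "cost f b (Var x) = of_bool (f x \<noteq> b)"
| "cost f b (Neg p) = cost f (\<not> b) p"
| "cost f b (Conj p q) = (if b then cost f b p + cost f b q else min (cost f b p) (cost f b q))"
| "cost f b (Disj p q) = (if b then min (cost f b p) (cost f b q) else cost f b p + cost f b q)"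

lemma min_eq_0_iff: "min a b = 0 \<longleftrightarrow> a = 0 \<or> b = (0::nat)"
  by (auto simp: min_def)

text \<open>The costs thereby also record the value of a gate: the final test of the program reads
  the value of the root off its cost of becoming false.\<close>

lemma cost_eq_0_iff: "cost f b p = 0 \<longleftrightarrow> eval f p = b"
proof (induction p arbitrary: b)
  case (Conj p q)
  then show ?case by (cases b) (simp_all add: min_eq_0_iff)
next
  case (Disj p q)
  then show ?case by (cases b) (simp_all add: min_eq_0_iff)
qed auto

lemma card_Int_Un_vars:
  "vars p \<inter> vars q = {} \<Longrightarrow>
    card (Z \<inter> (vars p \<union> vars q)) = card (Z \<inter> vars p) + card (Z \<inter> vars q)"
  by (subst Int_Un_distrib, rule card_Un_disjoint) auto

text \<open>Each input is taken with the value it has after the flips. Cutting \<open>Z\<close> down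
  to \<open>vars p\<close> makes it finite and its size additive over inputs without common
  variables.\<close>

lemma cost_le:
  "read_once p \<Longrightarrow> eval (flip f Z) p = b \<Longrightarrow> cost f b p \<le> card (Z \<inter> vars p)"
proof (induction p arbitrary: b)
  case (Var x)
  then show ?case by (auto simp: flip_def split: if_splits)
next
  case (Neg p)
  then show ?case by auto
next
  case (Conj p q)
  then have "cost f (eval (flip f Z) p) p \<le> card (Z \<inter> vars p)"
    "cost f (eval (flip f Z) q) q \<le> card (Z \<inter> vars q)" by auto
  with Conj.prems show ?case by (auto simp: card_Int_Un_vars)
next
  case (Disj p q)
  then have "cost f (eval (flip f Z) p) p \<le> card (Z \<inter> vars p)"
    "cost f (eval (flip f Z) q) q \<le> card (Z \<inter> vars q)" by auto
  with Disj.prems show ?case by (auto simp: card_Int_Un_vars)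
qed

text \<open>The two inputs of a gate can be steered independently, since each sees only its own part
  of the union.\<close>

lemma flip_Un_vars:
  assumes "vars p \<inter> vars q = {}" "A \<subseteq> vars p" "B \<subseteq> vars q"
  shows "eval (flip f (A \<union> B)) p = eval (flip f A) p"
    and "eval (flip f (A \<union> B)) q = eval (flip f B) q"
    and "card (A \<union> B) = card A + card B"
proof -
  show "eval (flip f (A \<union> B)) p = eval (flip f A) p" "eval (flip f (A \<union> B)) q = eval (flip f B) q"
    using assms by (auto intro!: eval_flip_cong)
  have "finite A" "finite B" using assms finite_subset finite_vars by blast+
  then show "card (A \<union> B) = card A + card B" using assms by (intro card_Un_disjoint) auto
qed

text \<open>Where both inputs are forced, their witnesses are joined; where one input decides the
  gate, the cheaper witness alone is used.\<close>

lemma cost_attained: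
  "read_once p \<Longrightarrow> \<exists>Z \<subseteq> vars p. eval (flip f Z) p = b \<and> card Z = cost f b p"
proof (induction p arbitrary: b)
  case (Var x)
  show ?case
  proof (cases "f x = b")
    case True
    then show ?thesis by (intro exI[of _ "{}"]) (simp add: flip_def)
  next
    case False
    then show ?thesis by (intro exI[of _ "{x}"]) (simp add: flip_def)
  qed
next
  case (Neg p)
  obtain Z where "Z \<subseteq> vars p" "eval (flip f Z) p = (\<not> b)" "card Z = cost f (\<not> b) p"
    using Neg.IH[of "\<not> b"] Neg.prems by (auto simp only: read_once_simps)
  then show ?case by (intro exI[of _ Z]) simp
next
  case (Conj p q)
  then have disj: "vars p \<inter> vars q = {}" by simp
  from Conj.prems have "read_once p" "read_once q" by auto
  with Conj.IH(1)[of b] Conj.IH(2)[of b] obtain A B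
    where AB: "A \<subseteq> vars p" "eval (flip f A) p = b" "card A = cost f b p"
      "B \<subseteq> vars q" "eval (flip f B) q = b" "card B = cost f b q"
    by blast
  show ?case
  proof (cases b)
    case True
    with AB flip_Un_vars[OF disj AB(1,4)] show ?thesis
      by (intro exI[of _ "A \<union> B"]) auto
  next
    case False
    with AB show ?thesis
      by (intro exI[of _ "if cost f b p \<le> cost f b q then A else B"]) auto
  qed
next
  case (Disj p q)
  then have disj: "vars p \<inter> vars q = {}" by simp
  from Disj.prems have "read_once p" "read_once q" by auto
  with Disj.IH(1)[of b] Disj.IH(2)[of b] obtain A B
    where AB: "A \<subseteq> vars p" "eval (flip f A) p = b" "card A = cost f b p"
      "B \<subseteq> vars q" "eval (flip f B) q = b" "card B = cost f b q"
    by blast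
  show ?case
  proof (cases b)
    case False
    with AB flip_Un_vars[OF disj AB(1,4)] show ?thesis
      by (intro exI[of _ "A \<union> B"]) auto
  next
    case True
    with AB show ?thesis
      by (intro exI[of _ "if cost f b p \<le> cost f b q then A else B"]) auto
  qed
qed

section \<open>Least numbers of flips that make a variable critical\<close>

text \<open>One more than the least number of flips of other variables that make \<open>X\<close> critical, so that \<open>0\<close> can mean that
  \<open>X\<close> does not occur.\<close>

fun crit_cost :: "'v \<Rightarrow> ('v \<Rightarrow> bool) \<Rightarrow> 'v formula \<Rightarrow> nat" where
  "crit_cost X f (Var x) = of_bool (x = X)"
| "crit_cost X f (Neg p) = crit_cost X f p"
| "crit_cost X f (Conj p q) =
     (if crit_cost X f p \<noteq> 0 then crit_cost X f p + cost f True q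
      else if crit_cost X f q \<noteq> 0 then crit_cost X f q + cost f True p else 0)"
| "crit_cost X f (Disj p q) =
     (if crit_cost X f p \<noteq> 0 then crit_cost X f p + cost f False q
      else if crit_cost X f q \<noteq> 0 then crit_cost X f q + cost f False p else 0)"

text \<open>The recursion descends to the single occurrence of \<open>X\<close> and accounts for
  negation. If \<open>X\<close> does not occur, the result is a meaningless default, so later uses
  are guarded by \<open>X \<in> vars p\<close> or by criticality.\<close>

fun literal_value :: "'v \<Rightarrow> ('v \<Rightarrow> bool) \<Rightarrow> 'v formula \<Rightarrow> bool" where
  "literal_value X f (Var x) = f x"
| "literal_value X f (Neg p) = (\<not> literal_value X f p)"
| "literal_value X f (Conj p q) =
     (if X \<in> vars q then literal_value X f q else literal_value X f p)"
| "literal_value X f (Disj p q) =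
     (if X \<in> vars q then literal_value X f q else literal_value X f p)"

lemma crit_cost_eq_0_iff: "crit_cost X f p = 0 \<longleftrightarrow> X \<notin> vars p"
  by (induction p) auto

lemma eval_flip_fresh: "X \<notin> vars p \<Longrightarrow> eval (flip f {X}) p = eval f p"
  by (rule eval_cong) (auto simp: flip_def)

lemma critical_simps [simp]:
  "critical X (Var x) f \<longleftrightarrow> x = X"
  "critical X (Neg p) f \<longleftrightarrow> critical X p f"
  by (auto simp: critical_def flip_def)

text \<open>\<open>X\<close> lies below at most one input. The other input ignores the flip of
  \<open>X\<close> and lets the change pass only if it has the neutral value of the
  operator.\<close>

lemma critical_gate:
  assumes "vars p \<inter> vars q = {}"
  shows "critical X (Conj p q) f \<longleftrightarrow> critical X p f \<and> eval f q \<or> critical X q f \<and> eval f p"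
    and "critical X (Disj p q) f \<longleftrightarrow> critical X p f \<and> \<not> eval f q \<or> critical X q f \<and> \<not> eval f p"
proof -
  have "X \<notin> vars p \<or> X \<notin> vars q" using assms by blast
  then show "critical X (Conj p q) f \<longleftrightarrow> critical X p f \<and> eval f q \<or> critical X q f \<and> eval f p"
    and "critical X (Disj p q) f \<longleftrightarrow> critical X p f \<and> \<not> eval f q \<or> critical X q f \<and> \<not> eval f p"
    by (auto simp: critical_def eval_flip_fresh)
qed

lemma critical_vars: "critical X p f \<Longrightarrow> X \<in> vars p"
  using eval_flip_fresh by (fastforce simp: critical_def)

lemma critical_cong:
  assumes "Z \<inter> vars p = Z' \<inter> vars p"
  shows "critical X p (flip f Z) = critical X p (flip f Z')"
proof -
  have "eval (flip (flip f Z) {X}) p = eval (flip (flip f Z') {X}) p"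
    using assms by (intro eval_cong) (auto simp: flip_def)
  then show ?thesis using eval_flip_cong[OF assms, of f] by (simp add: critical_def)
qed

text \<open>A read-once formula is monotone in the literal of \<open>X\<close>, so a gate for which \<open>X\<close> is
  critical has the value of that literal.\<close>

lemma critical_eval:
  "read_once p \<Longrightarrow> critical X p f \<Longrightarrow> eval f p = literal_value X f p"
  by (induction p) (auto simp: critical_gate dest: critical_vars)

text \<open>Together with \<open>critical_eval\<close> this shows that all sets avoiding
  \<open>X\<close> after which \<open>X\<close> is critical leave the same value at the
  root.\<close>

lemma literal_value_flip:
  "X \<in> vars p \<Longrightarrow> X \<notin> Z \<Longrightarrow> literal_value X (flip f Z) p = literal_value X f p"
proof (induction p)
  case (Var x)
  then show ?case by (simp add: flip_def)
qed auto

text \<open>The input below which \<open>X\<close> lies contributes its induction hypothesis, the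
  other one the cost of its neutral value. Preservation of the value is not assumed, so the
  hypothesis applies directly to an input.\<close>

lemma crit_cost_le:
  "read_once p \<Longrightarrow> critical X p (flip f Z) \<Longrightarrow> crit_cost X f p \<le> Suc (card (Z \<inter> vars p))"
proof (induction p)
  case (Conj p q)
  then have disj: "vars p \<inter> vars q = {}" by simp
  consider "critical X p (flip f Z)" "eval (flip f Z) q"
    | "critical X q (flip f Z)" "eval (flip f Z) p"
    using Conj.prems critical_gate(1)[OF disj] by blast
  then show ?case
  proof cases
    case 1
    with Conj cost_le[of q f Z True] critical_vars[OF 1(1)] show ?thesis
      by (simp add: crit_cost_eq_0_iff card_Int_Un_vars)
  next
    case 2
    then have "X \<notin> vars p" using disj critical_vars by fastforce
    with 2 Conj cost_le[of p f Z True] critical_vars[OF 2(1)] show ?thesis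
      by (simp add: crit_cost_eq_0_iff card_Int_Un_vars)
  qed
next
  case (Disj p q)
  then have disj: "vars p \<inter> vars q = {}" by simp
  consider "critical X p (flip f Z)" "\<not> eval (flip f Z) q"
    | "critical X q (flip f Z)" "\<not> eval (flip f Z) p"
    using Disj.prems critical_gate(2)[OF disj] by blast
  then show ?case
  proof cases
    case 1
    with Disj cost_le[of q f Z False] critical_vars[OF 1(1)] show ?thesis
      by (simp add: crit_cost_eq_0_iff card_Int_Un_vars)
  next
    case 2
    then have "X \<notin> vars p" using disj critical_vars by fastforce
    with 2 Disj cost_le[of p f Z False] critical_vars[OF 2(1)] show ?thesis
      by (simp add: crit_cost_eq_0_iff card_Int_Un_vars)
  qed
qed auto

text \<open>\<open>B\<close> cannot contain \<open>X\<close>, which occurs in \<open>p\<close>.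
  Exchanging \<open>p\<close> and \<open>q\<close> covers the case that \<open>X\<close> lies below
  the second input.\<close>

lemma critical_flip_Un:
  assumes disj: "vars p \<inter> vars q = {}"
    and A: "A \<subseteq> vars p - {X}" "critical X p (flip f A)"
    and B: "B \<subseteq> vars q" "eval (flip f B) q = b"
  shows "A \<union> B \<subseteq> vars p \<union> vars q - {X}" "critical X p (flip f (A \<union> B))"
    "eval (flip f (A \<union> B)) q = b" "card (A \<union> B) = card A + card B"
proof -
  have "X \<in> vars p" using A critical_vars by fast
  then show "A \<union> B \<subseteq> vars p \<union> vars q - {X}" using A B disj by blast
  show "critical X p (flip f (A \<union> B))"
    using critical_cong[of "A \<union> B" p A X f] A B disj by blast
  show "eval (flip f (A \<union> B)) q = b" "card (A \<union> B) = card A + card B"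
    using flip_Un_vars[OF disj _ B(1), of A] A B by auto
qed

text \<open>A witness for the input containing \<open>X\<close> is joined with a cheapest set that
  gives the other input its neutral value.\<close>

lemma crit_cost_attained:
  "read_once p \<Longrightarrow> X \<in> vars p \<Longrightarrow>
    \<exists>Z \<subseteq> vars p - {X}. critical X p (flip f Z) \<and> crit_cost X f p = Suc (card Z)"
proof (induction p)
  case (Conj p q)
  then have disj: "vars p \<inter> vars q = {}" and disj': "vars q \<inter> vars p = {}"
    and ro: "read_once p" "read_once q" by auto
  show ?case
  proof (cases "X \<in> vars p")
    case True
    obtain A where A: "A \<subseteq> vars p - {X}" "critical X p (flip f A)" "crit_cost X f p = Suc (card A)"
      using Conj True ro by blast
    obtain B where B: "B \<subseteq> vars q" "eval (flip f B) q = True" "card B = cost f True q"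
      using cost_attained[OF ro(2)] by blast
    show ?thesis
      using critical_flip_Un[OF disj A(1,2) B(1,2)] A B
      by (intro exI[of _ "A \<union> B"]) (auto simp: critical_gate[OF disj])
  next
    case False
    then have "X \<in> vars q" using Conj by simp
    obtain A where A: "A \<subseteq> vars q - {X}" "critical X q (flip f A)" "crit_cost X f q = Suc (card A)"
      using Conj \<open>X \<in> vars q\<close> ro by blast
    obtain B where B: "B \<subseteq> vars p" "eval (flip f B) p = True" "card B = cost f True p"
      using cost_attained[OF ro(1)] by blast
    have "crit_cost X f p = 0" using False by (simp add: crit_cost_eq_0_iff)
    then show ?thesis
      using critical_flip_Un[OF disj' A(1,2) B(1,2)] A B
      by (intro exI[of _ "A \<union> B"]) (auto simp: critical_gate[OF disj])
  qed
next
  case (Disj p q)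
  then have disj: "vars p \<inter> vars q = {}" and disj': "vars q \<inter> vars p = {}"
    and ro: "read_once p" "read_once q" by auto
  show ?case
  proof (cases "X \<in> vars p")
    case True
    obtain A where A: "A \<subseteq> vars p - {X}" "critical X p (flip f A)" "crit_cost X f p = Suc (card A)"
      using Disj True ro by blast
    obtain B where B: "B \<subseteq> vars q" "eval (flip f B) q = False" "card B = cost f False q"
      using cost_attained[OF ro(2)] by blast
    show ?thesis
      using critical_flip_Un[OF disj A(1,2) B(1,2)] A B
      by (intro exI[of _ "A \<union> B"]) (auto simp: critical_gate[OF disj])
  next
    case False
    then have "X \<in> vars q" using Disj by simp
    obtain A where A: "A \<subseteq> vars q - {X}" "critical X q (flip f A)" "crit_cost X f q = Suc (card A)"
      using Disj \<open>X \<in> vars q\<close> ro by blast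
    obtain B where B: "B \<subseteq> vars p" "eval (flip f B) p = False" "card B = cost f False p"
      using cost_attained[OF ro(1)] by blast
    have "crit_cost X f p = 0" using False by (simp add: crit_cost_eq_0_iff)
    then show ?thesis
      using critical_flip_Un[OF disj' A(1,2) B(1,2)] A B
      by (intro exI[of _ "A \<union> B"]) (auto simp: critical_gate[OF disj])
  qed
qed auto

text \<open>Reduces the minimisation over sets to three recursively computable quantities. The
  summand 1 in the denominator of \<open>dr\<close> is already part of
  \<open>crit_cost\<close>.\<close>

lemma dr_read_once:
  assumes ro: "read_once p" and V: "finite V" "vars p \<subseteq> V"
  shows "dr V p X f =
    (if X \<in> vars p \<and> eval f p = literal_value X f p then 1 / of_nat (crit_cost X f p) else 0)"
proof (cases "X \<in> vars p \<and> eval f p = literal_value X f p")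
  case True
  obtain Z where Z: "Z \<subseteq> vars p - {X}" "critical X p (flip f Z)" "crit_cost X f p = Suc (card Z)"
    using crit_cost_attained[OF ro] True by blast
  \<comment> \<open>Preservation of the value comes for free: after the flips the root has the value
    of the literal, which \<open>Z\<close> does not touch.\<close>
  have "eval (flip f Z) p = eval f p"
    using critical_eval[OF ro Z(2)] literal_value_flip[of X p Z f] True Z(1) by blast
  then have mc: "makes_critical V Z X p f" using Z V by (auto simp: makes_critical_def)
  \<comment> \<open>\<open>Z'\<close> may also contain variables outside the formula; the lower
    bound concerns its part inside \<open>vars p\<close>.\<close>
  have min: "card Z \<le> card Z'" if "makes_critical V Z' X p f" for Z'
  proof -
    have Z': "critical X p (flip f Z')" "finite Z'"
      using that V finite_subset by (fastforce simp: makes_critical_def)+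
    have "card (Z' \<inter> vars p) \<le> card Z'" using Z' by (intro card_mono) auto
    then show ?thesis using crit_cost_le[OF ro Z'(1)] Z(3) by simp
  qed
  have "(LEAST n. \<exists>Z. makes_critical V Z X p f \<and> card Z = n) = card Z"
    using mc min by (intro Least_equality) auto
  then show ?thesis using mc Z(3) True by (auto simp: dr_def)
next
  case False
  \<comment> \<open>A set making \<open>X\<close> critical would give the root the value of the
    literal and also preserve its old value, so the two would agree.\<close>
  have "\<not> makes_critical V Z X p f" for Z
  proof
    assume mc: "makes_critical V Z X p f"
    then have c: "critical X p (flip f Z)" "X \<notin> Z" "eval (flip f Z) p = eval f p"
      by (auto simp: makes_critical_def)
    then show False
      using critical_vars[OF c(1)] critical_eval[OF ro c(1)] literal_value_flip[of X p Z f] False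
      by metis
  qed
  then show ?thesis using False by (auto simp: dr_def)
qed

section \<open>Symbolic execution\<close>

definition bounded :: "nat \<Rightarrow> (nat \<Rightarrow> nat) \<Rightarrow> bool" where
  "bounded w R \<longleftrightarrow> (\<forall>j. R j \<le> w)"

lemma boundedD: "bounded w R \<Longrightarrow> R j \<le> w"
  by (simp add: bounded_def)

lemma bounded_upd: "bounded w R \<Longrightarrow> v \<le> w \<Longrightarrow> bounded w (R(r := v))"
  by (simp add: bounded_def)

lemma bounded_diff: "bounded w R \<Longrightarrow> R j - x \<le> w"
  using boundedD[of w R j] by linarith

definition reaches :: "instr list \<Rightarrow> nat \<Rightarrow> nat \<Rightarrow> config \<Rightarrow> (config \<Rightarrow> bool) \<Rightarrow> bool" where
  "reaches P w t s Q \<longleftrightarrow>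
     (\<exists>m\<le>t. Q ((step P ^^ m) s) \<and>
       (\<forall>i\<le>m. bounded w (reg ((step P ^^ i) s)) \<and> bounded w (mem ((step P ^^ i) s))))"

lemma reaches_refl:
  "Q s \<Longrightarrow> bounded w (reg s) \<Longrightarrow> bounded w (mem s) \<Longrightarrow> reaches P w t s Q"
  by (auto simp: reaches_def intro!: exI[of _ 0])

text \<open>Applied backwards to a goal, it executes one instruction; \<open>reaches_mono\<close>
  discards the unspent budget at the end of a block.\<close>

lemma reaches_step:
  assumes "0 < t" "l < length P" "bounded w R" "bounded w M"
    and "reaches P w (t - 1) (exec_instr (P ! l) (Config l R M)) Q"
  shows "reaches P w t (Config l R M) Q"
proof -
  let ?s = "Config l R M"
  have step: "step P ?s = exec_instr (P ! l) ?s"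
    using assms(2) by (simp add: step_def halted_def)
  obtain m where m: "m \<le> t - 1" "Q ((step P ^^ m) (step P ?s))"
    "\<And>i. i \<le> m \<Longrightarrow> bounded w (reg ((step P ^^ i) (step P ?s))) \<and>
      bounded w (mem ((step P ^^ i) (step P ?s)))"
    using assms(5) unfolding reaches_def step by blast
  have "bounded w (reg ((step P ^^ i) ?s)) \<and> bounded w (mem ((step P ^^ i) ?s))"
    if "i \<le> Suc m" for i
  proof (cases i)
    case 0
    then show ?thesis using assms by simp
  next
    case (Suc j)
    then show ?thesis using m(3)[of j] that by (simp add: funpow_swap1)
  qed
  then show ?thesis
    using m(1,2) assms(1) unfolding reaches_def
    by (intro exI[of _ "Suc m"]) (auto simp: funpow_swap1)
qed

lemma reaches_mono: "reaches P w t s Q \<Longrightarrow> t \<le> t' \<Longrightarrow> reaches P w t' s Q"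
  unfolding reaches_def using le_trans by blast

section \<open>The program and its blocks\<close>

text \<open>Registers 0, 1, 2 hold the input length, the reading position and the first free cell of
  a stack placed behind the input; register 3 the value of the literal of \<open>X\<close>, once it has been
  read; register 4 the variable \<open>X\<close>, and register 5 the constant 1. An evaluated subformula \<open>p\<close>
  occupies three stack cells, with \<open>cost f True p\<close>, \<open>cost f False p\<close> and \<open>crit_cost X f p\<close>, and
  a pending operator one cell, with 0 for conjunction and 1 for disjunction. For a disjunction,
  the code at 68--73 and 83--85 swaps the two costs, which reduces it to a conjunction. The blocks
  start at 0 (initialisation), 7 (loop), 22 (negation), 26 (literal), 47 (conjunction sign),
  50 (disjunction sign), 53 (right parenthesis), 74 (combining two inputs), 93 (output).\<close>

definition responsibility_program :: "instr list" where
  "responsibility_program = [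
    Set 5 1, Load 4 9, Add 4 4 5, Move 1 4, Load 4 4, Add 1 1 5, Move 2 0,
    Sub 6 0 1, JumpZero 6 93, Load 6 1, Add 1 1 5, JumpZero 6 7, Sub 6 6 5,
    JumpZero 6 53, Sub 6 6 5, JumpZero 6 47, Sub 6 6 5, JumpZero 6 50, Sub 6 6 5,
    JumpZero 6 22, Set 7 0, Jump 26,
    Set 7 4, Load 6 1, Add 1 1 5, Sub 6 6 7,
    Load 8 6, Sub 6 6 5, JumpZero 7 30, Sub 8 5 8,
    Sub 9 5 8, Store 2 9, Add 2 2 5, Store 2 8, Add 2 2 5, Sub 9 6 4, Sub 10 4 6,
    Add 9 9 10, JumpZero 9 43, Set 9 0, Store 2 9, Add 2 2 5, Jump 7,
    Move 3 8, Store 2 5, Add 2 2 5, Jump 7,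
    Store 2 6, Add 2 2 5, Jump 7,
    Store 2 5, Add 2 2 5, Jump 7,
    Sub 2 2 5, Load 10 2, Sub 2 2 5, Load 9 2, Sub 2 2 5, Load 8 2, Sub 2 2 5,
    Load 14 2, Sub 2 2 5, Load 13 2, Sub 2 2 5, Load 12 2, Sub 2 2 5, Load 11 2,
    JumpZero 14 74, Move 15 8, Move 8 9, Move 9 15, Move 15 11, Move 11 12, Move 12 15,
    JumpZero 13 77, Add 13 13 8, Jump 79,
    JumpZero 10 79, Add 13 10 11,
    Add 8 8 11, Sub 15 9 12, Sub 9 9 15, JumpZero 14 86, Move 15 8, Move 8 9,
    Move 9 15,
    Store 2 8, Add 2 2 5, Store 2 9, Add 2 2 5, Store 2 13, Add 2 2 5, Jump 7,
    Sub 2 2 5, Load 8 2, Sub 2 2 5, Load 9 2, JumpZero 8 102, JumpZero 9 101,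
    JumpZero 3 102, Jump 105,
    JumpZero 3 105,
    Set 0 0, Set 1 1, Jump 107,
    Set 0 1, Move 1 8]"

lemma length_program: "length responsibility_program = 107"
  by (simp add: responsibility_program_def)

text \<open>Needed for the first instruction of a block, where the restricted rule
  \<open>exec_inner\<close> does not apply.\<close>

lemma exec_first:
  assumes "l < 107 \<and> 0 < t \<and> bounded w R \<and> bounded w M" "responsibility_program ! l = I"
    and "reaches responsibility_program w (t - 1) (exec_instr I (Config l R M)) Q"
  shows "reaches responsibility_program w t (Config l R M) Q"
  using assms by (intro reaches_step) (simp_all add: length_program)

text \<open>The entry points of the loop (7), of a literal (26) and of a binary gate (74) are
  excluded, so that iterating this rule stops where the next lemma takes over.\<close>

lemma exec_inner:
  assumes "l \<noteq> 7 \<and> l \<noteq> 26 \<and> l \<noteq> 74 \<and> l < 107 \<and> 0 < t \<and> bounded w R \<and> bounded w M"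
    and "responsibility_program ! l = I"
    and "reaches responsibility_program w (t - 1) (exec_instr I (Config l R M)) Q"
  shows "reaches responsibility_program w t (Config l R M) Q"
  using assms by (intro exec_first) simp_all

text \<open>The invariant shared by all blocks. Register 3 is left out because it changes when the
  literal of \<open>X\<close> is read; the block lemmas track it separately.\<close>

definition frame where
  "frame w n X i sp R M \<longleftrightarrow>
     R 0 = n \<and> R 1 = i \<and> R 2 = sp \<and> R 4 = X \<and> R 5 = (1::nat) \<and> bounded w R \<and> bounded w M"

lemmas exec_simps = responsibility_program_def boundedD bounded_upd bounded_diff

text \<open>Each block is treated in continuation-passing style: if \<open>Q\<close> is reached within \<open>t\<close> steps
  from the exit of the block, then it is reached within \<open>t\<close> plus a constant from its entry. The
  block is thus executed by simplification without composing postconditions.\<close>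

lemma run_literal:
  assumes fr: "frame w n X i sp R M" and sp: "sp + 3 \<le> w"
    and x: "R 6 = Suc x" "M (Suc x) = of_bool b" "X + x \<le> w"
    and v: "v \<longleftrightarrow> b \<noteq> (R 7 \<noteq> 0)"
    and cont: "\<And>R' M'. frame w n X i (sp + 3) R' M' \<Longrightarrow>
      M' sp = of_bool (\<not> v) \<Longrightarrow> M' (sp + 1) = of_bool v \<Longrightarrow> M' (sp + 2) = of_bool (x = X) \<Longrightarrow>
      \<forall>j<sp. M' j = M j \<Longrightarrow> R' 3 = (if x = X then of_bool v else R 3) \<Longrightarrow>
      reaches responsibility_program w t (Config 7 R' M') Q"
  shows "reaches responsibility_program w (t + 30) (Config 26 R M) Q"
  apply (insert fr sp x v, unfold frame_def)
  apply (cases "R 7 = 0"; cases b; cases x X rule: linorder_cases)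
  apply ((rule exec_first, (simp add: exec_simps; fail), (simp add: exec_simps; fail), simp,
        (rule exec_inner, (simp add: exec_simps; fail), (simp add: exec_simps; fail), simp)+,
        rule reaches_mono, rule cont, (simp_all add: frame_def exec_simps)[7])+)
  done

lemma run_open:
  assumes fr: "frame w n X i sp R M" and i: "i < n" "n \<le> w" "M i = 0"
    and cont: "\<And>R'. frame w n X (i + 1) sp R' M \<Longrightarrow> R' 3 = R 3 \<Longrightarrow>
      reaches responsibility_program w t (Config 7 R' M) Q"
  shows "reaches responsibility_program w (t + 100) (Config 7 R M) Q"
  apply (insert fr i, unfold frame_def)
  apply (rule exec_first, (simp add: exec_simps; fail), (simp add: exec_simps; fail), simp)
  apply ((rule exec_inner, (simp add: exec_simps; fail), (simp add: exec_simps; fail), simp)+)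
  apply (rule reaches_mono, rule cont, simp_all add: frame_def exec_simps)
  done

lemma run_operator:
  assumes fr: "frame w n X i sp R M" and i: "i < n" "n \<le> w" "M i = 2 + of_bool d" "sp < w" "3 \<le> w"
    and cont: "\<And>R' M'. frame w n X (i + 1) (sp + 1) R' M' \<Longrightarrow> R' 3 = R 3 \<Longrightarrow>
      M' sp = of_bool d \<Longrightarrow> \<forall>j<sp. M' j = M j \<Longrightarrow>
      reaches responsibility_program w t (Config 7 R' M') Q"
  shows "reaches responsibility_program w (t + 100) (Config 7 R M) Q"
  apply (insert fr i, unfold frame_def)
  apply (cases d)
  apply (rule exec_first, (simp add: exec_simps; fail), (simp add: exec_simps; fail), simp)
  apply ((rule exec_inner, (simp add: exec_simps; fail), (simp add: exec_simps; fail), simp)+)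
  apply (rule reaches_mono, rule cont, (simp_all add: frame_def exec_simps)[5])
  apply (rule exec_first, (simp add: exec_simps; fail), (simp add: exec_simps; fail), simp)
  apply ((rule exec_inner, (simp add: exec_simps; fail), (simp add: exec_simps; fail), simp)+)
  apply (rule reaches_mono, rule cont, simp_all add: frame_def exec_simps)
  done

text \<open>The dispatch on symbols subtracts 1 four times, which turns \<open>5 + x\<close> into
  \<open>Suc x\<close>, the address of the value of \<open>x\<close> in the input.\<close>

lemma run_positive:
  assumes fr: "frame w n X i sp R M" and i: "i < n" "n \<le> w" "M i = 5 + x"
    and cont: "\<And>R'. frame w n X (i + 1) sp R' M \<Longrightarrow> R' 3 = R 3 \<Longrightarrow> R' 6 = Suc x \<Longrightarrow> R' 7 = 0 \<Longrightarrow>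
      reaches responsibility_program w t (Config 26 R' M) Q"
  shows "reaches responsibility_program w (t + 20) (Config 7 R M) Q"
proof -
  have "5 + x \<le> w" using fr i boundedD[of w M i] by (simp add: frame_def)
  then show ?thesis
    apply (insert fr i, unfold frame_def)
    apply (rule exec_first, (simp add: exec_simps; fail), (simp add: exec_simps; fail), simp)
    apply ((rule exec_inner, (simp add: exec_simps; fail), (simp add: exec_simps; fail), simp)+)
    apply (rule reaches_mono, rule cont, simp_all add: frame_def exec_simps)
    done
qed

text \<open>The 4 in register 7 serves twice: it is subtracted from \<open>5 + x\<close> to give the
  address \<open>Suc x\<close>, and being nonzero it marks the literal as negative.\<close>

lemma run_negative:
  assumes fr: "frame w n X i sp R M" and i: "i + 1 < n" "n \<le> w" "M i = 4" "M (i + 1) = 5 + x"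
    and cont: "\<And>R'. frame w n X (i + 2) sp R' M \<Longrightarrow> R' 3 = R 3 \<Longrightarrow> R' 6 = Suc x \<Longrightarrow> R' 7 = 4 \<Longrightarrow>
      reaches responsibility_program w t (Config 26 R' M) Q"
  shows "reaches responsibility_program w (t + 20) (Config 7 R M) Q"
proof -
  have "5 + x \<le> w" using fr i boundedD[of w M "i + 1"] by (simp add: frame_def)
  then show ?thesis
    apply (insert fr i, unfold frame_def)
    apply (rule exec_first, (simp add: exec_simps; fail), (simp add: exec_simps; fail), simp)
    apply ((rule exec_inner, (simp add: exec_simps; fail), (simp add: exec_simps; fail), simp)+)
    apply (rule reaches_mono, rule cont, simp_all add: frame_def exec_simps)
    done
qed

text \<open>Registers 11 and 8 hold the costs of the neutral value for the first and second input,
  12 and 9 those of the opposite value. The minimum \<open>min a b\<close> arises from truncated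
  subtraction as \<open>b - (b - a)\<close>.\<close>

lemma run_gate:
  assumes fr: "frame w n X i sp R M" and sp: "sp + 3 \<le> w" and d: "R 14 = of_bool d"
    and w: "R 11 + R 8 \<le> w" "R 13 + R 8 \<le> w" "R 10 + R 11 \<le> w"
    and cont: "\<And>R' M'. frame w n X i (sp + 3) R' M' \<Longrightarrow> R' 3 = R 3 \<Longrightarrow> \<forall>j<sp. M' j = M j \<Longrightarrow>
      M' sp = (if d then min (R 12) (R 9) else R 11 + R 8) \<Longrightarrow>
      M' (sp + 1) = (if d then R 11 + R 8 else min (R 12) (R 9)) \<Longrightarrow>
      M' (sp + 2) = (if R 13 \<noteq> 0 then R 13 + R 8 else if R 10 \<noteq> 0 then R 10 + R 11 else 0) \<Longrightarrow>
      reaches responsibility_program w t (Config 7 R' M') Q"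
  shows "reaches responsibility_program w (t + 30) (Config 74 R M) Q"
  apply (insert fr sp d w, unfold frame_def)
  apply (cases d; cases "R 13 = 0"; cases "R 10 = 0")
  apply ((rule exec_first, (simp add: exec_simps; fail), (simp add: exec_simps; fail), simp,
        (rule exec_inner, (simp add: exec_simps; fail), (simp add: exec_simps; fail), simp)+,
        rule reaches_mono, rule cont, (simp_all add: frame_def exec_simps min_def)[7])+)
  done

text \<open>Addresses are written \<open>4 + sp\<close> because simplifying \<open>sp + 7 - 1 - 1 - 1\<close> gives this form.\<close>

lemma run_close:
  assumes fr: "frame w n X i (sp + 7) R M" and i: "i < n" "n \<le> w" "M i = 1"
    and sp: "sp + 7 \<le> w" and d: "M (3 + sp) = of_bool d"
    and w: "M sp + M (4 + sp) \<le> w" "M (sp + 1) + M (5 + sp) \<le> w"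
      "M (sp + 2) + M ((if d then 5 else 4) + sp) \<le> w"
      "M (6 + sp) + M (of_bool d + sp) \<le> w"
    and cont: "\<And>R' M'. frame w n X (i + 1) (sp + 3) R' M' \<Longrightarrow> R' 3 = R 3 \<Longrightarrow> \<forall>j<sp. M' j = M j \<Longrightarrow>
      M' sp = (if d then min (M sp) (M (4 + sp)) else M sp + M (4 + sp)) \<Longrightarrow>
      M' (sp + 1) =
        (if d then M (sp + 1) + M (5 + sp) else min (M (sp + 1)) (M (5 + sp))) \<Longrightarrow>
      M' (sp + 2) =
        (if M (sp + 2) \<noteq> 0 then M (sp + 2) + M ((if d then 5 else 4) + sp)
         else if M (6 + sp) \<noteq> 0 then M (6 + sp) + M (of_bool d + sp) else 0) \<Longrightarrow>
      reaches responsibility_program w t (Config 7 R' M') Q"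
  shows "reaches responsibility_program w (t + 100) (Config 7 R M) Q"
  apply (insert fr i sp d w, unfold frame_def)
  apply (cases d)
   apply (rule exec_first, (simp add: exec_simps; fail), (simp add: exec_simps; fail), simp)
   apply ((rule exec_inner, (simp add: exec_simps; fail), (simp add: exec_simps; fail), simp)+)
   apply (rule reaches_mono,
       rule run_gate[where d = True and n = n and X = X and i = "i + 1" and sp = sp])
          apply (simp_all add: frame_def exec_simps)[6]
    apply (rule cont; simp add: frame_def exec_simps)
   apply simp
   apply (rule exec_first, (simp add: exec_simps; fail), (simp add: exec_simps; fail), simp)
   apply ((rule exec_inner, (simp add: exec_simps; fail), (simp add: exec_simps; fail), simp)+)
   apply (rule reaches_mono,
       rule run_gate[where d = False and n = n and X = X and i = "i + 1" and sp = sp])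
          apply (simp_all add: frame_def exec_simps)[6]
    apply (rule cont; simp add: frame_def exec_simps)
   apply simp
  done

text \<open>Register 9, still 0, is the address from which the number \<open>k\<close> of variables
  is loaded; \<open>X\<close> is then found in cell \<open>k + 1\<close>.\<close>

lemma run_prologue:
  assumes R: "R 0 = n" "R 3 = 0" "R 9 = 0" "bounded w R" and M: "M 0 = k" "bounded w M"
    and k: "k + 2 \<le> n" "n \<le> w"
    and cont: "\<And>R'. frame w n (M (k + 1)) (k + 2) n R' M \<Longrightarrow> R' 3 = 0 \<Longrightarrow>
      reaches responsibility_program w t (Config 7 R' M) Q"
  shows "reaches responsibility_program w (t + 10) (Config 0 R M) Q"
  apply (insert R M k)
  apply ((rule exec_inner, (simp add: exec_simps del: One_nat_def; fail),
      (simp add: exec_simps del: One_nat_def; fail), simp del: One_nat_def)+)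
  apply (rule reaches_mono, rule cont, simp_all add: frame_def exec_simps del: One_nat_def)
  done

text \<open>The cell at \<open>Suc sp\<close> is the root's cost of becoming false. Comparing its
  being 0 with register 3 being 0 compares the root with the literal of \<open>X\<close>.\<close>

lemma run_epilogue:
  assumes fr: "frame w n X n (sp + 3) R M" and n: "sp + 3 \<le> w" "2 \<le> w"
    and Q: "\<And>s. halted responsibility_program s \<Longrightarrow>
      (reg s 0, reg s 1) =
        (if M (2 + sp) \<noteq> 0 \<and> (M (Suc sp) = 0 \<longleftrightarrow> R 3 = 0) then (1, M (2 + sp)) else (0, 1)) \<Longrightarrow>
      Q s"
  shows "reaches responsibility_program w (t + 20) (Config 7 R M) Q"
  apply (insert fr n, unfold frame_def)
  apply (cases "M (2 + sp) = 0"; cases "M (Suc sp) = 0"; cases "R 3 = 0")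
  apply ((rule exec_first, (simp add: exec_simps; fail), (simp add: exec_simps; fail), simp,
        (rule exec_inner, (simp add: exec_simps; fail), (simp add: exec_simps; fail), simp)+,
        rule reaches_refl, rule Q,
        simp add: halted_def length_program, (simp_all add: exec_simps)[3])+)
  done

section \<open>Correctness of the pass over the formula\<close>

lemma cost_le_length: "cost f b p \<le> length (encode p)"
  by (induction p arbitrary: b)
    (auto simp: min_le_iff_disj le_SucI trans_le_add1 add_le_mono)

text \<open>With \<open>cost_le_length\<close> this keeps all stack entries linear in the input
  length.\<close>

lemma crit_cost_le_length: "crit_cost X f p \<le> length (encode p)"
proof (induction p)
  case (Conj p q)
  then show ?case using cost_le_length[of f True p] cost_le_length[of f True q] by auto
next
  case (Disj p q)
  then show ?case using cost_le_length[of f False p] cost_le_length[of f False q] by auto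
qed auto

definition stored :: "(nat \<Rightarrow> nat) \<Rightarrow> nat \<Rightarrow> nat list \<Rightarrow> bool" where
  "stored M i xs \<longleftrightarrow> (\<forall>j < length xs. M (i + j) = xs ! j)"

lemma stored_Nil [simp]: "stored M i []"
  by (simp add: stored_def)

lemma stored_Cons [simp]: "stored M i (x # xs) \<longleftrightarrow> M i = x \<and> stored M (i + 1) xs"
  by (auto simp: stored_def nth_Cons less_Suc_eq_0_disj split: nat.splits)

lemma stored_append [simp]:
  "stored M i (xs @ ys) \<longleftrightarrow> stored M i xs \<and> stored M (i + length xs) ys"
  by (induction xs arbitrary: i) auto

text \<open>Code below the stack survives writes to the stack.\<close>

lemma stored_cong:
  "stored M i xs \<Longrightarrow> \<forall>j<sp. M' j = M j \<Longrightarrow> i + length xs \<le> sp \<Longrightarrow> stored M' i xs"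
  by (simp add: stored_def)

text \<open>Quantifying over position, stack pointer, state and continuation makes this usable as an
  induction hypothesis for both operands. Three stack cells per symbol are a generous
  allowance.\<close>

definition computes ::
  "nat \<Rightarrow> nat \<Rightarrow> nat \<Rightarrow> nat \<Rightarrow> (nat \<Rightarrow> bool) \<Rightarrow> nat formula \<Rightarrow> bool" where
  "computes w n k X f p \<longleftrightarrow> (\<forall>i sp R M t Q.
     frame w n X i sp R M \<longrightarrow> stored M i (encode p) \<longrightarrow> i + length (encode p) \<le> n \<longrightarrow>
     n \<le> sp \<longrightarrow> sp + 3 * length (encode p) \<le> w \<longrightarrow> (\<forall>x<k. M (Suc x) = of_bool (f x)) \<longrightarrow>
     (\<forall>R' M'. frame w n X (i + length (encode p)) (sp + 3) R' M' \<longrightarrow>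
        M' sp = cost f True p \<longrightarrow> M' (sp + 1) = cost f False p \<longrightarrow> M' (sp + 2) = crit_cost X f p \<longrightarrow>
        (\<forall>j<sp. M' j = M j) \<longrightarrow>
        R' 3 = (if X \<in> vars p then of_bool (literal_value X f p) else R 3) \<longrightarrow>
        reaches responsibility_program w t (Config 7 R' M') Q) \<longrightarrow>
     reaches responsibility_program w (t + 100 * length (encode p)) (Config 7 R M) Q)"

lemma computesI:
  assumes "\<And>i sp R M t Q. frame w n X i sp R M \<Longrightarrow> stored M i (encode p) \<Longrightarrow>
     i + length (encode p) \<le> n \<Longrightarrow>
     n \<le> sp \<Longrightarrow> sp + 3 * length (encode p) \<le> w \<Longrightarrow> (\<forall>x<k. M (Suc x) = of_bool (f x)) \<Longrightarrow>
     (\<And>R' M'. frame w n X (i + length (encode p)) (sp + 3) R' M' \<Longrightarrow>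
        M' sp = cost f True p \<Longrightarrow> M' (sp + 1) = cost f False p \<Longrightarrow> M' (sp + 2) = crit_cost X f p \<Longrightarrow>
        \<forall>j<sp. M' j = M j \<Longrightarrow>
        R' 3 = (if X \<in> vars p then of_bool (literal_value X f p) else R 3) \<Longrightarrow>
        reaches responsibility_program w t (Config 7 R' M') Q) \<Longrightarrow>
     reaches responsibility_program w (t + 100 * length (encode p)) (Config 7 R M) Q"
  shows "computes w n k X f p"
  unfolding computes_def by (intro allI impI assms) auto

lemma computesD:
  assumes "computes w n k X f p" "frame w n X i sp R M" "stored M i (encode p)"
     "i + length (encode p) \<le> n"
     "n \<le> sp" "sp + 3 * length (encode p) \<le> w" "\<forall>x<k. M (Suc x) = of_bool (f x)"
     "\<And>R' M'. frame w n X (i + length (encode p)) (sp + 3) R' M' \<Longrightarrow>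
        M' sp = cost f True p \<Longrightarrow> M' (sp + 1) = cost f False p \<Longrightarrow> M' (sp + 2) = crit_cost X f p \<Longrightarrow>
        \<forall>j<sp. M' j = M j \<Longrightarrow>
        R' 3 = (if X \<in> vars p then of_bool (literal_value X f p) else R 3) \<Longrightarrow>
        reaches responsibility_program w t (Config 7 R' M') Q"
  shows "reaches responsibility_program w (t + 100 * length (encode p)) (Config 7 R M) Q"
  using assms unfolding computes_def by blast

text \<open>The test \<open>x = X\<close> adds both truncated differences of the indices;
  \<open>2 * n \<le> w\<close> yields the bound on \<open>X + x\<close> that
  \<open>run_literal\<close> asks for.\<close>

lemma computes_Var:
  assumes "x < k" "X < k" "k \<le> n" "2 * n \<le> w"
  shows "computes w n k X f (Var x)"
proof (rule computesI)
  fix i sp R M t Q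
  assume fr: "frame w n X i sp R M" and code: "stored M i (encode (Var x))"
    and bnd: "i + length (encode (Var x)) \<le> n" "n \<le> sp" "sp + 3 * length (encode (Var x)) \<le> w"
    and f: "\<forall>x<k. M (Suc x) = of_bool (f x)"
    and cont: "\<And>R' M'. frame w n X (i + length (encode (Var x))) (sp + 3) R' M' \<Longrightarrow>
        M' sp = cost f True (Var x) \<Longrightarrow> M' (sp + 1) = cost f False (Var x) \<Longrightarrow>
        M' (sp + 2) = crit_cost X f (Var x) \<Longrightarrow> \<forall>j<sp. M' j = M j \<Longrightarrow>
        R' 3 = (if X \<in> vars (Var x) then of_bool (literal_value X f (Var x)) else R 3) \<Longrightarrow>
        reaches responsibility_program w t (Config 7 R' M') Q"
  have "reaches responsibility_program w (t + 30 + 20) (Config 7 R M) Q"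
  proof (rule run_positive[OF fr, where x = x])
    fix R'
    assume R': "frame w n X (i + 1) sp R' M" "R' 3 = R 3" "R' 6 = Suc x" "R' 7 = 0"
    show "reaches responsibility_program w (t + 30) (Config 26 R' M) Q"
      by (rule run_literal[OF R'(1), where x = x and b = "f x" and v = "f x"])
        (use assms bnd f R' in \<open>auto intro!: cont\<close>)
  qed (use assms code bnd in auto)
  then show "reaches responsibility_program w (t + 100 * length (encode (Var x))) (Config 7 R M) Q"
    by (rule reaches_mono) simp
qed

lemma computes_Neg_Var:
  assumes "x < k" "X < k" "k \<le> n" "2 * n \<le> w"
  shows "computes w n k X f (Neg (Var x))"
proof (rule computesI)
  fix i sp R M t Q
  assume fr: "frame w n X i sp R M" and code: "stored M i (encode (Neg (Var x)))"
    and bnd: "i + length (encode (Neg (Var x))) \<le> n" "n \<le> sp"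
      "sp + 3 * length (encode (Neg (Var x))) \<le> w"
    and f: "\<forall>x<k. M (Suc x) = of_bool (f x)"
    and cont: "\<And>R' M'. frame w n X (i + length (encode (Neg (Var x)))) (sp + 3) R' M' \<Longrightarrow>
        M' sp = cost f True (Neg (Var x)) \<Longrightarrow> M' (sp + 1) = cost f False (Neg (Var x)) \<Longrightarrow>
        M' (sp + 2) = crit_cost X f (Neg (Var x)) \<Longrightarrow> \<forall>j<sp. M' j = M j \<Longrightarrow>
        R' 3 = (if X \<in> vars (Neg (Var x)) then of_bool (literal_value X f (Neg (Var x))) else R 3) \<Longrightarrow>
        reaches responsibility_program w t (Config 7 R' M') Q"
  have "reaches responsibility_program w (t + 30 + 20) (Config 7 R M) Q"
  proof (rule run_negative[OF fr, where x = x])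
    fix R'
    assume R': "frame w n X (i + 2) sp R' M" "R' 3 = R 3" "R' 6 = Suc x" "R' 7 = 4"
    show "reaches responsibility_program w (t + 30) (Config 26 R' M) Q"
      by (rule run_literal[OF R'(1), where x = x and b = "f x" and v = "\<not> f x"])
        (use assms bnd f R' in \<open>auto intro!: cont\<close>)
  qed (use assms code bnd in auto)
  then show "reaches responsibility_program w (t + 100 * length (encode (Neg (Var x)))) (Config 7 R M) Q"
    by (rule reaches_mono) simp
qed

text \<open>Treats both operators in one proof; \<open>d\<close> is the bit kept in the operator
  cell of the stack.\<close>

definition gate :: "bool \<Rightarrow> 'v formula \<Rightarrow> 'v formula \<Rightarrow> 'v formula" where
  "gate d p q = (if d then Disj p q else Conj p q)"

text \<open>Five runs are chained by continuations. The three symbols of the gate itself cost 100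
  steps each, which gives exactly 100 per symbol.\<close>

lemma computes_gate:
  assumes p: "computes w n k X f p" and q: "computes w n k X f q"
    and k: "k < n" "2 * n \<le> w" "3 \<le> w"
  shows "computes w n k X f (gate d p q)"
proof (rule computesI)
  fix i sp R M t Q
  let ?g = "gate d p q" and ?lp = "length (encode p)" and ?lq = "length (encode q)"
  have enc: "encode ?g = [0] @ encode p @ [2 + of_bool d] @ encode q @ [1]"
    by (simp add: gate_def)
  assume fr: "frame w n X i sp R M" and code: "stored M i (encode ?g)"
    and bnd: "i + length (encode ?g) \<le> n" "n \<le> sp" "sp + 3 * length (encode ?g) \<le> w"
    and f: "\<forall>x<k. M (Suc x) = of_bool (f x)"
    and cont: "\<And>R' M'. frame w n X (i + length (encode ?g)) (sp + 3) R' M' \<Longrightarrow>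
        M' sp = cost f True ?g \<Longrightarrow> M' (sp + 1) = cost f False ?g \<Longrightarrow>
        M' (sp + 2) = crit_cost X f ?g \<Longrightarrow> \<forall>j<sp. M' j = M j \<Longrightarrow>
        R' 3 = (if X \<in> vars ?g then of_bool (literal_value X f ?g) else R 3) \<Longrightarrow>
        reaches responsibility_program w t (Config 7 R' M') Q"
  have c0: "M i = 0" and cp: "stored M (i + 1) (encode p)"
    and cd: "M (i + 1 + ?lp) = 2 + of_bool d" and cq: "stored M (i + 1 + ?lp + 1) (encode q)"
    and c1: "M (i + 1 + ?lp + 1 + ?lq) = 1"
    using code unfolding enc by (simp_all add: add_ac)
  have len: "i + ?lp + ?lq + 3 \<le> n" "sp + 3 * (?lp + ?lq + 3) \<le> w"
    using bnd unfolding enc by simp_all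
  have "reaches responsibility_program w (t + 100 + 100 * ?lq + 100 + 100 * ?lp + 100) (Config 7 R M) Q"
  proof (rule run_open[OF fr])
    fix R1
    assume 1: "frame w n X (i + 1) sp R1 M" "R1 3 = R 3"
    show "reaches responsibility_program w (t + 100 + 100 * ?lq + 100 + 100 * ?lp) (Config 7 R1 M) Q"
    proof (rule computesD[OF p 1(1) cp])
      fix R2 M2
      assume 2: "frame w n X (i + 1 + ?lp) (sp + 3) R2 M2"
        "M2 sp = cost f True p" "M2 (sp + 1) = cost f False p" "M2 (sp + 2) = crit_cost X f p"
        "\<forall>j<sp. M2 j = M j"
        "R2 3 = (if X \<in> vars p then of_bool (literal_value X f p) else R1 3)"
      show "reaches responsibility_program w (t + 100 + 100 * ?lq + 100) (Config 7 R2 M2) Q"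
      proof (rule run_operator[OF 2(1), where d = d])
        fix R3 M3
        assume 3: "frame w n X (i + 1 + ?lp + 1) (sp + 3 + 1) R3 M3" "R3 3 = R2 3"
          "M3 (sp + 3) = of_bool d" "\<forall>j<sp + 3. M3 j = M2 j"
        have M3: "\<forall>j<sp. M3 j = M j" using 2(5) 3(4) by simp
        show "reaches responsibility_program w (t + 100 + 100 * ?lq) (Config 7 R3 M3) Q"
        proof (rule computesD[OF q 3(1)])
          fix R4 M4
          assume 4: "frame w n X (i + 1 + ?lp + 1 + ?lq) (sp + 3 + 1 + 3) R4 M4"
            "M4 (sp + 3 + 1) = cost f True q" "M4 (sp + 3 + 1 + 1) = cost f False q"
            "M4 (sp + 3 + 1 + 2) = crit_cost X f q" "\<forall>j<sp + 3 + 1. M4 j = M3 j"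
            "R4 3 = (if X \<in> vars q then of_bool (literal_value X f q) else R3 3)"
          have M4: "\<forall>j<sp. M4 j = M j" using 4(5) M3 by simp
          \<comment> \<open>The seven cells above \<open>sp\<close>: the triple of \<open>p\<close>,
            the operator bit, the triple of \<open>q\<close>.\<close>
          have vals: "M4 sp = cost f True p" "M4 (Suc sp) = cost f False p"
            "M4 (2 + sp) = crit_cost X f p" "M4 (3 + sp) = of_bool d" "M4 (4 + sp) = cost f True q"
            "M4 (5 + sp) = cost f False q" "M4 (6 + sp) = crit_cost X f q"
            using 2 3 4 by (simp_all add: add.commute)
          have le: "cost f b p \<le> ?lp" "cost f b q \<le> ?lq" "crit_cost X f p \<le> ?lp"
            "crit_cost X f q \<le> ?lq" for b
            by (simp_all add: cost_le_length crit_cost_le_length)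
          have sum_le: "a + b \<le> w" if "a \<le> ?lp" "b \<le> ?lq" for a b
            using add_mono[OF that] len by simp
          have sums: "cost f b p + cost f b q \<le> w" "crit_cost X f p + cost f b q \<le> w"
            "crit_cost X f q + cost f b p \<le> w" for b
            using sum_le[OF le(1,2)] sum_le[OF le(3,2)] sum_le[OF le(1,4)] by (simp_all add: add.commute)
          have fr4: "frame w n X (i + 1 + ?lp + 1 + ?lq) (sp + 7) R4 M4"
            using 4(1) by (simp add: add.commute)
          show "reaches responsibility_program w (t + 100) (Config 7 R4 M4) Q"
          proof (rule run_close[OF fr4, where d = d])
            fix R5 M5
            assume 5: "frame w n X (i + 1 + ?lp + 1 + ?lq + 1) (sp + 3) R5 M5" "R5 3 = R4 3"
              "\<forall>j<sp. M5 j = M4 j"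
              "M5 sp = (if d then min (M4 sp) (M4 (4 + sp)) else M4 sp + M4 (4 + sp))"
              "M5 (sp + 1) = (if d then M4 (sp + 1) + M4 (5 + sp) else min (M4 (sp + 1)) (M4 (5 + sp)))"
              "M5 (sp + 2) = (if M4 (sp + 2) \<noteq> 0 then M4 (sp + 2) + M4 ((if d then 5 else 4) + sp)
                else if M4 (6 + sp) \<noteq> 0 then M4 (6 + sp) + M4 (of_bool d + sp) else 0)"
            show "reaches responsibility_program w t (Config 7 R5 M5) Q"
            proof (rule cont)
              show "frame w n X (i + length (encode ?g)) (sp + 3) R5 M5"
                using 5(1) unfolding enc by (simp add: add_ac)
              show "\<forall>j<sp. M5 j = M j" using 5(3) M4 by simp
              show "M5 sp = cost f True ?g" "M5 (sp + 1) = cost f False ?g"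
                "M5 (sp + 2) = crit_cost X f ?g"
                using 5(4-6) vals by (simp_all add: gate_def)
              show "R5 3 = (if X \<in> vars ?g then of_bool (literal_value X f ?g) else R 3)"
                using 5(2) 4(6) 3(2) 2(6) 1(2) by (auto simp: gate_def)
            qed
          qed (use k len vals sums bnd M4 c1 in auto)
        next
          \<comment> \<open>The code of \<open>q\<close> lies in the input, below the stack, and was
            not overwritten by the run on \<open>p\<close>.\<close>
          show "stored M3 (i + 1 + ?lp + 1) (encode q)"
            using cq M3 by (rule stored_cong) (use len bnd in linarith)
        qed (use len bnd M3 f k in auto)
      qed (use k len bnd cd 2(5) in auto)
    qed (use len bnd f in auto)
  qed (use k len c0 in auto)
  then show "reaches responsibility_program w (t + 100 * length (encode ?g)) (Config 7 R M) Q"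
    unfolding enc by (simp add: algebra_simps)
qed


text \<open>Positive normal form reduces the case of a negation to a negated variable.\<close>

lemma computes_formula:
  assumes k: "X < k" "k < n" "2 * n \<le> w" "3 \<le> w"
  shows "positive_normal_form p \<Longrightarrow> vars p \<subseteq> {..<k} \<Longrightarrow> computes w n k X f p"
proof (induction p)
  case (Var x)
  then show ?case using k by (intro computes_Var) auto
next
  case (Neg p)
  then show ?case using k by (auto intro!: computes_Neg_Var)
next
  case (Conj p q)
  then show ?case using computes_gate[of w n k X f p q False] k by (simp add: gate_def)
next
  case (Disj p q)
  then show ?case using computes_gate[of w n k X f p q True] k by (simp add: gate_def)
qed

section \<open>Linear bounds for the whole run\<close>

lemma encode_le: "vars p \<subseteq> {..<k} \<Longrightarrow> s \<in> set (encode p) \<Longrightarrow> s \<le> 4 + k"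
  by (induction p) auto

theorem theorem3:
  "\<exists>(P :: instr list) (c :: nat).
     \<forall>(k :: nat) (\<phi> :: nat formula) (X :: nat) (f :: nat \<Rightarrow> bool).
       read_once \<phi> \<and> positive_normal_form \<phi> \<and> vars \<phi> \<subseteq> {..<k} \<and> X \<in> {..<k} \<longrightarrow>
       (\<exists>num den. runs P (input k f X \<phi>)
                    (c * length (input k f X \<phi>)) (c * length (input k f X \<phi>)) num den \<and>
                  den \<noteq> 0 \<and> dr {..<k} \<phi> X f = of_nat num / of_nat den)"
proof (rule exI[of _ responsibility_program], rule exI[of _ 100], intro allI impI)
  fix k X :: nat and \<phi> :: "nat formula" and f :: "nat \<Rightarrow> bool"
  assume asm: "read_once \<phi> \<and> positive_normal_form \<phi> \<and> vars \<phi> \<subseteq> {..<k} \<and> X \<in> {..<k}"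
  let ?xs = "input k f X \<phi>" and ?len = "length (encode \<phi>)"
  define n where "n = length ?xs"
  define w where "w = 100 * n"
  define M where "M = (\<lambda>i. if i < length ?xs then ?xs ! i else 0)"
  define m where "m = crit_cost X f \<phi>"
  define good where "good \<longleftrightarrow> X \<in> vars \<phi> \<and> eval f \<phi> = literal_value X f \<phi>"
  \<comment> \<open>If the responsibility is 0, the output is the fraction 0/1, so that the
    denominator never vanishes.\<close>
  define num den where "num = (of_bool good :: nat)" and "den = (if good then m else 1)"
  have n: "n = k + 2 + ?len" by (simp add: n_def input_def)
  have "X < k" using asm by simp
  have M0: "M 0 = k" by (simp add: M_def input_def)
  have MX: "M (k + 1) = X" by (simp add: M_def input_def nth_append)
  have Mf: "\<forall>x<k. M (Suc x) = of_bool (f x)" by (simp add: M_def input_def nth_append)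
  have code: "stored M (k + 2) (encode \<phi>)"
    by (simp add: M_def input_def stored_def nth_append)
  have "x \<le> w" if "x \<in> set ?xs" for x
    using that encode_le[of \<phi> k x] asm \<open>X < k\<close> by (auto simp: input_def w_def n)
  then have Mw: "bounded w M" by (simp add: bounded_def M_def)
  have "reaches responsibility_program w (0 + 20 + 100 * ?len + 10) (Config 0 ((\<lambda>_. 0)(0 := n)) M)
    (\<lambda>s. halted responsibility_program s \<and> reg s 0 = num \<and> reg s 1 = den)"
  proof (rule run_prologue[where k = k and n = n])
    fix R1
    assume 1: "frame w n (M (k + 1)) (k + 2) n R1 M" "R1 3 = 0"
    have comp: "computes w n k X f \<phi>"
      using asm \<open>X < k\<close> n by (intro computes_formula) (auto simp: w_def)
    show "reaches responsibility_program w (0 + 20 + 100 * ?len) (Config 7 R1 M)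
      (\<lambda>s. halted responsibility_program s \<and> reg s 0 = num \<and> reg s 1 = den)"
    proof (rule computesD[OF comp 1(1)[unfolded MX] code _ _ _ Mf])
      fix R2 M2
      assume 2: "frame w n X (k + 2 + ?len) (n + 3) R2 M2" "M2 n = cost f True \<phi>"
        "M2 (n + 1) = cost f False \<phi>" "M2 (n + 2) = crit_cost X f \<phi>"
        "R2 3 = (if X \<in> vars \<phi> then of_bool (literal_value X f \<phi>) else R1 3)"
      have res: "(M2 (2 + n) \<noteq> 0 \<and> (M2 (Suc n) = 0 \<longleftrightarrow> R2 3 = 0)) = good"
        using 2(3-5) by (auto simp: good_def crit_cost_eq_0_iff cost_eq_0_iff)
      show "reaches responsibility_program w (0 + 20) (Config 7 R2 M2)
        (\<lambda>s. halted responsibility_program s \<and> reg s 0 = num \<and> reg s 1 = den)"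
        using 2(1,4) res
        by (intro run_epilogue[where n = n and X = X and sp = n])
          (auto simp: n w_def num_def den_def m_def)
    qed (auto simp: n w_def)
  qed (use M0 Mw n in \<open>auto simp: bounded_def w_def\<close>)
  \<comment> \<open>The 30 steps of prologue and epilogue are paid for by the \<open>k + 2\<close>
    input words in front of the formula.\<close>
  then have "reaches responsibility_program w (100 * n) (Config 0 ((\<lambda>_. 0)(0 := n)) M)
    (\<lambda>s. halted responsibility_program s \<and> reg s 0 = num \<and> reg s 1 = den)"
    by (rule reaches_mono) (simp add: n)
  then have "runs responsibility_program ?xs (100 * length ?xs) (100 * length ?xs) num den"
    by (simp add: reaches_def runs_def Let_def initial_def bounded_def n_def M_def w_def) blast
  moreover have "den \<noteq> 0" using crit_cost_eq_0_iff[of X f \<phi>] by (auto simp: den_def good_def m_def)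
  moreover have "dr {..<k} \<phi> X f = of_nat num / of_nat den"
    using asm by (simp add: dr_read_once num_def den_def m_def good_def)
  ultimately show "\<exists>num den. runs responsibility_program ?xs (100 * length ?xs) (100 * length ?xs) num den \<and>
      den \<noteq> 0 \<and> dr {..<k} \<phi> X f = of_nat num / of_nat den"
    by blast
qed

end
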